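(* For any access graph $G$ which contains a path of length at least $k+1$ (i.e., with at least $k+1$ vertices), the relative worst order ratio of FWF to FIFO on $G$ satisfies $$\mathrm{WR}^G_{\mathrm{FWF},\mathrm{FIFO}}\ge \frac{2k}{k+1}.$$
   Context: Paging: a cache of size $k\ge1$, initially empty; on a request to a page not in cache (a fault) the page is brought in, evicting a page if the cache is full; $\mathrm{A}(I)$ is the number of faults of algorithm $\mathrm{A}$ on $I$. FIFO evicts the page that has been in cache the longest. FWF (Flush-When-Full) evicts all pages from the cache whenever a fault occurs while the cache is full. An access graph is an undirected graph whose vertices are the pages; a sequence respects it if any two consecutive requests are to the same page or to adjacent vertices. The length of a path is its number of vertices. For an algorithm $\mathrm{A}$ and access graph $G$, $\mathrm{A}^G_W(I)=\max_\sigma \mathrm{A}(\sigma(I))$ over all permutations $\sigma$ of the requests of $I$ such that $\sigma(I)$ respects $G$. Relative worst order ratio on $G$: $c_l(\mathrm{A},\mathrm{B})=\sup\{c\mid \exists b\ \forall I \text{ respecting } G:\ \mathrm{A}^G_W(I)\ge c\,\mathrm{B}^G_W(I)-b\}$, $c_u(\mathrm{A},\mathrm{B})=\inf\{c\mid \exists b\ \forall I \text{ respecting } G:\ \mathrm{A}^G_W(I)\le c\,\mathrm{B}^G_W(I)+b\}$. If $c_l\ge1$ then $\mathrm{WR}^G_{\mathrm{A},\mathrm{B}}=c_u(\mathrm{A},\mathrm{B})$; if $c_u\le1$ then $\mathrm{WR}^G_{\mathrm{A},\mathrm{B}}=c_l(\mathrm{A},\mathrm{B})$; otherwise it is undefined.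 *)

theory Defs
  imports "HOL-Library.Multiset" "HOL-Library.Extended_Real" "Graph_Theory.Vertex_Walk"
begin

section \<open>Paging algorithms\<close>

text \<open>The parameter \<open>pages\<close> extracts the set of cached pages from the internal state of an algorithm.\<close>

fun faults :: "('s \<Rightarrow> 'a set) \<Rightarrow> ('s \<Rightarrow> 'a \<Rightarrow> 's) \<Rightarrow> 's \<Rightarrow> 'a list \<Rightarrow> nat" where
  "faults pages step s [] = 0"
| "faults pages step s (p # I) =
     (if p \<in> pages s then 0 else 1) + faults pages step (step s p) I"

text \<open>The FIFO cache is a queue, with the page that has been in cache the longest at its head.\<close>

definition fifo_step :: "nat \<Rightarrow> 'a list \<Rightarrow> 'a \<Rightarrow> 'a list" where
  "fifo_step k q p =
     (if p \<in> set q then q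
      else if length q < k then q @ [p]
      else tl q @ [p])"

definition FIFO :: "nat \<Rightarrow> 'a list \<Rightarrow> nat" where
  "FIFO k I = faults set (fifo_step k) [] I"

definition fwf_step :: "nat \<Rightarrow> 'a set \<Rightarrow> 'a \<Rightarrow> 'a set" where
  "fwf_step k C p =
     (if p \<in> C then C
      else if card C < k then insert p C
      else {p})"

definition FWF :: "nat \<Rightarrow> 'a list \<Rightarrow> nat" where
  "FWF k I = faults (\<lambda>C. C) (fwf_step k) {} I"


section \<open>Access graphs and the relative worst order ratio\<close>

text \<open>
  An access graph is a symmetric digraph; each undirected edge is a pair of opposite arcs.
\<close>

definition respects_graph :: "('a, 'b) pre_digraph \<Rightarrow> 'a list \<Rightarrow> bool" where
  "respects_graph G I \<longleftrightarrow> set I \<subseteq> verts G \<and> successively (\<lambda>u v. u = v \<or> u \<rightarrow>\<^bsub>G\<^esub> v) I"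

text \<open>
  The maximum is over a finite set, which is nonempty whenever \<open>I\<close> itself respects \<open>G\<close>.
\<close>

definition worst_order :: "('a, 'b) pre_digraph \<Rightarrow> ('a list \<Rightarrow> nat) \<Rightarrow> 'a list \<Rightarrow> nat" where
  "worst_order G A I = Max {A J |J. mset J = mset I \<and> respects_graph G J}"

text \<open>Supremum and infimum are taken in the extended reals, since the sets need not be bounded.\<close>

definition c_l :: "('a, 'b) pre_digraph \<Rightarrow> ('a list \<Rightarrow> nat) \<Rightarrow> ('a list \<Rightarrow> nat) \<Rightarrow> ereal" where
  "c_l G A B = Sup (ereal ` {c. \<exists>b. \<forall>I. respects_graph G I \<longrightarrow>
     real (worst_order G A I) \<ge> c * real (worst_order G B I) - b})"

definition c_u :: "('a, 'b) pre_digraph \<Rightarrow> ('a list \<Rightarrow> nat) \<Rightarrow> ('a list \<Rightarrow> nat) \<Rightarrow> ereal" where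
  "c_u G A B = Inf (ereal ` {c. \<exists>b. \<forall>I. respects_graph G I \<longrightarrow>
     real (worst_order G A I) \<le> c * real (worst_order G B I) + b})"

text \<open>\<open>None\<close> means that the ratio is undefined.\<close>

definition WR :: "('a, 'b) pre_digraph \<Rightarrow> ('a list \<Rightarrow> nat) \<Rightarrow> ('a list \<Rightarrow> nat) \<Rightarrow> ereal option" where
  "WR G A B =
     (if c_l G A B \<ge> 1 then Some (c_u G A B)
      else if c_u G A B \<le> 1 then Some (c_l G A B)
      else None)"

end

(*
  FIFO is conservative: during one phase of FWF it faults at most once on each page of the phase,
  whereas FWF faults exactly once on each of them.  Hence FIFO <= FWF on every sequence and
  c_l >= 1.

  For c_u, walk n times back and forth along a path v_1, ..., v_{k+1}.  FWF faults on all 2kn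
  requests.  On k+1 pages a full FIFO cache misses exactly one page, which is always the page it
  evicted last, so the faults run through the k+1 pages cyclically.  As v_1 is requested only n
  times, every reordering of the walk causes at most (k+1)n + 2k FIFO faults, whatever further
  edges the graph has.
*)

theory Submission
  imports Defs
begin

lemma faults_append:
  "faults pages step s (I @ J) = faults pages step s I + faults pages step (foldl step s I) J"
  by (induction I arbitrary: s) auto

lemma fifo_step_fault:
  "p \<notin> set q \<Longrightarrow> fifo_step k q p = (if length q < k then q else tl q) @ [p]"
  by (simp add: fifo_step_def)

lemma fifo_step_invariant:
  assumes "distinct q" "length q \<le> k" "k \<ge> 1"
  shows "distinct (fifo_step k q p)" "length (fifo_step k q p) \<le> k"
  using assms by (cases q; auto simp: fifo_step_def)+

lemma set_fifo_step: "set (fifo_step k q p) \<subseteq> insert p (set q)"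
  by (cases q) (auto simp: fifo_step_def)


section \<open>FIFO faults at most as often as FWF\<close>

text \<open>An evicted page is always the head of \<open>a\<close>: if \<open>a\<close> is empty,
  the queue is shorter than \<open>k\<close> and nothing is evicted.\<close>

lemma fifo_fault_suffix:
  assumes "p \<notin> set (a @ b)" "length b < k"
    and "length (a @ b) \<le> k"
  shows "\<exists>a'. fifo_step k (a @ b) p = a' @ b @ [p]"
  using assms by (cases a) (auto simp: fifo_step_fault)

text \<open>
  Here \<open>b\<close> lists the pages on which FIFO has faulted in the current phase of FWF, and \<open>C\<close> is the
  set of all pages of that phase.
\<close>

lemma faults_fifo_le_fwf:
  assumes "distinct (a @ b)" "length (a @ b) \<le> k" "k \<ge> 1"
    and "finite C" "card C \<le> k" "set b \<subseteq> C"
  shows "faults set (fifo_step k) (a @ b) I + length b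
           \<le> faults (\<lambda>C. C) (fwf_step k) C I + card C"
  using assms
proof (induction I arbitrary: a b C)
  case Nil
  then show ?case
    by (metis add_0 card_mono distinct_append distinct_card faults.simps(1))
next
  case (Cons p I)
  let ?q = "a @ b"
  have b_le: "length b \<le> card C"
    using Cons.prems by (metis card_mono distinct_append distinct_card)
  have inv: "distinct (fifo_step k ?q p)" "length (fifo_step k ?q p) \<le> k"
    using fifo_step_invariant[OF Cons.prems(1-3)] by auto
  define C' where "C' = fwf_step k C p"
  have C': "finite C'" "card C' \<le> k"
    using Cons.prems by (auto simp: C'_def fwf_step_def card_insert_if)
  have IH: "faults set (fifo_step k) (fifo_step k ?q p) I + length b'
              \<le> faults (\<lambda>C. C) (fwf_step k) C' I + card C'"
    if "fifo_step k ?q p = a' @ b'" "set b' \<subseteq> C'" for a' b'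
    using Cons.IH[of a' b' C'] that inv Cons.prems(3) C' by simp
  show ?case
  proof (cases "p \<in> C \<or> card C < k")
    case True
    have C'_eq: "C' = insert p C"
      using True by (auto simp: C'_def fwf_step_def)
    \<comment> \<open>Within a phase \<open>card C\<close> grows exactly when FWF faults, so the
      right-hand side of the claim does not change with the request.\<close>
    have cost: "card C' = (if p \<in> C then 0 else 1) + card C"
      using Cons.prems by (auto simp: C'_eq insert_absorb)
    show ?thesis
    proof (cases "p \<in> set ?q")
      case hit: True
      then have "fifo_step k ?q p = a @ b"
        by (simp add: fifo_step_def)
      moreover have "set b \<subseteq> C'"
        using Cons.prems by (auto simp: C'_eq)
      ultimately have "faults set (fifo_step k) (fifo_step k ?q p) I + length b
          \<le> faults (\<lambda>C. C) (fwf_step k) C' I + card C'"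
        by (rule IH)
      with hit cost show ?thesis
        by (simp add: C'_def[symmetric])
    next
      case miss: False
      \<comment> \<open>\<open>p\<close> and the pages of \<open>b\<close> are distinct pages of one
        phase, which has at most \<open>k\<close> pages; hence no eviction can hit
        \<open>b\<close>.\<close>
      have "length b < k"
      proof (cases "p \<in> C")
        case True
        then have "card (insert p (set b)) \<le> card C"
          using Cons.prems by (intro card_mono) auto
        then show ?thesis
          using miss Cons.prems by (simp add: distinct_card)
      next
        case False
        then show ?thesis
          using \<open>p \<in> C \<or> card C < k\<close> b_le by simp
      qed
      then obtain a' where "fifo_step k ?q p = a' @ b @ [p]"
        using fifo_fault_suffix miss Cons.prems(2) by metis
      moreover have "set (b @ [p]) \<subseteq> C'"
        using Cons.prems by (auto simp: C'_eq)
      ultimately have "faults set (fifo_step k) (fifo_step k ?q p) I + length (b @ [p])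
          \<le> faults (\<lambda>C. C) (fwf_step k) C' I + card C'"
        by (rule IH)
      with miss cost show ?thesis
        by (simp add: C'_def[symmetric])
    qed
  next
    case False
    then have C'_eq: "C' = {p}" and full: "p \<notin> C" "card C = k"
      using Cons.prems by (auto simp: C'_def fwf_step_def)
    show ?thesis
    proof (cases "p \<in> set ?q")
      case hit: True
      have "fifo_step k ?q p = fifo_step k ?q p @ []"
        by simp
      from IH[OF this] hit full b_le show ?thesis
        by (auto simp: C'_eq C'_def[symmetric])
    next
      case miss: False
      have "fifo_step k ?q p = (if length ?q < k then ?q else tl ?q) @ [p]"
        using miss by (rule fifo_step_fault)
      from IH[OF this] miss full b_le show ?thesis
        by (auto simp: C'_eq C'_def[symmetric])
    qed
  qed
qed

lemma FIFO_le_FWF: "k \<ge> 1 \<Longrightarrow> FIFO k I \<le> FWF k I"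
  using faults_fifo_le_fwf[of "[]" "[]" k "{}" I] by (simp add: FIFO_def FWF_def)


section \<open>FIFO on k + 1 pages\<close>

text \<open>
  An upper bound on the number of faults that FIFO incurs on \<open>k + 1\<close> pages before its next fault
  on \<open>x\<close>; the term \<open>2 * k - length q\<close> is the number of faults that fill the cache plus \<open>k\<close>.
\<close>

definition fifo_slack :: "nat \<Rightarrow> 'a \<Rightarrow> 'a list \<Rightarrow> nat" where
  "fifo_slack k x q =
     (if length q < k then 2 * k - length q
      else if x \<in> set q then Suc (length (takeWhile (\<lambda>y. y \<noteq> x) q))
      else 0)"

lemma length_takeWhile_neq_less: "x \<in> set q \<Longrightarrow> length (takeWhile (\<lambda>y. y \<noteq> x) q) < length q"
  by (induction q) auto

lemma fifo_slack_le: "length q = k \<Longrightarrow> fifo_slack k x q \<le> k"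
  by (auto simp: fifo_slack_def Suc_le_eq length_takeWhile_neq_less)

text \<open>Amortization: a fault on another page is paid for by a drop of the slack. With a full
  cache, a fault on \<open>x\<close> gets a credit of \<open>k + 1\<close>, covering itself and the
  new slack of at most \<open>k\<close>.\<close>

lemma fifo_slack_fault:
  assumes "card S = k + 1" "x \<in> S" "p \<in> S" "p \<notin> set q" "k \<ge> 1"
    and "distinct q" "length q \<le> k" "set q \<subseteq> S"
  shows "Suc (fifo_slack k x (fifo_step k q p))
           \<le> fifo_slack k x q + (if p = x then k + 1 else 0)"
proof (cases "length q < k")
  case True
  then have step: "fifo_step k q p = q @ [p]"
    using assms by (simp add: fifo_step_fault)
  show ?thesis
  proof (cases "Suc (length q) < k")
    case True
    then show ?thesis
      unfolding step by (simp add: fifo_slack_def)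
  next
    case False
    \<comment> \<open>The request fills the last slot: \<open>length q = k - 1\<close>, so the slack
      falls from \<open>k + 1\<close> to at most \<open>k\<close>.\<close>
    then have "fifo_slack k x (q @ [p]) \<le> k"
      using True by (intro fifo_slack_le) simp
    moreover have "fifo_slack k x q = Suc k"
      using True False by (simp add: fifo_slack_def)
    ultimately show ?thesis
      unfolding step by simp
  qed
next
  case False
  with assms have len: "length q = k"
    by simp
  then obtain z r where q: "q = z # r"
    using assms by (cases q) auto
  have step: "fifo_step k q p = r @ [p]"
    using len assms by (simp add: fifo_step_fault q)
  show ?thesis
  proof (cases "p = x")
    case True
    have "fifo_slack k x (r @ [p]) \<le> k"
      using len q by (intro fifo_slack_le) simp
    with True show ?thesis
      unfolding step by simp
  next
    case neq: False
    have "finite S"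
      using assms by (metis add_is_0 card.infinite one_neq_zero)
    \<comment> \<open>The \<open>k\<close> cached pages and \<open>p\<close> exhaust
      \<open>S\<close>, so \<open>x\<close>, being different from \<open>p\<close>, is
      cached.\<close>
    then have "insert p (set q) = S"
      using assms len by (intro card_subset_eq) (auto simp: distinct_card)
    with neq have x: "x \<in> set q"
      using assms by auto
    \<comment> \<open>Either \<open>x\<close> is the head and its eviction lowers the slack from 1
      to 0, or it moves one place towards the head.\<close>
    have "fifo_slack k x (r @ [p]) < fifo_slack k x q"
    proof (cases "x = z")
      case True
      then show ?thesis
        using len neq assms by (auto simp: fifo_slack_def q)
    next
      case False
      then have "x \<in> set r"
        using x q by simp
      then show ?thesis
        using len False by (auto simp: fifo_slack_def q takeWhile_append1)
    qed
    with neq show ?thesis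
      unfolding step by simp
  qed
qed

lemma faults_fifo_le_count:
  assumes "card S = k + 1" "x \<in> S" "set I \<subseteq> S" "k \<ge> 1"
    and "distinct q" "length q \<le> k" "set q \<subseteq> S"
  shows "faults set (fifo_step k) q I \<le> (k + 1) * count_list I x + fifo_slack k x q"
  using assms
proof (induction I arbitrary: q)
  case Nil
  then show ?case
    by simp
next
  case (Cons p I)
  show ?case
  proof (cases "p \<in> set q")
    case True
    then have "fifo_step k q p = q"
      by (simp add: fifo_step_def)
    with True Cons.IH[of q] Cons.prems show ?thesis
      by auto
  next
    case False
    have "set (fifo_step k q p) \<subseteq> S"
      using set_fifo_step[of k q p] Cons.prems by auto
    then have "faults set (fifo_step k) (fifo_step k q p) I
        \<le> (k + 1) * count_list I x + fifo_slack k x (fifo_step k q p)"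
      using Cons.IH Cons.prems fifo_step_invariant[of q k p] by simp
    moreover have "Suc (fifo_slack k x (fifo_step k q p))
        \<le> fifo_slack k x q + (if p = x then k + 1 else 0)"
      using fifo_slack_fault[of S k x p q] False Cons.prems by simp
    ultimately show ?thesis
      using False by (auto split: if_splits)
  qed
qed

text \<open>The bound sees only the set of pages and the number of requests to \<open>x\<close>, so
  it is the same for all reorderings; \<open>2 * k\<close> is the slack of the empty cache.\<close>

lemma FIFO_le_count:
  assumes "card S = k + 1" "x \<in> S" "set I \<subseteq> S" "k \<ge> 1"
  shows "FIFO k I \<le> (k + 1) * count_list I x + 2 * k"
  using faults_fifo_le_count[OF assms, of "[]"] assms(4) by (simp add: FIFO_def fifo_slack_def)


section \<open>Walking back and forth along a path\<close>

text \<open>Each half of a round stops one vertex short of the turning point, which opens the next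
  half; on a path, \<open>x\<close> and \<open>y\<close> thus occur once per round.\<close>

definition zigzag :: "'a \<Rightarrow> 'a list \<Rightarrow> 'a \<Rightarrow> nat \<Rightarrow> 'a list" where
  "zigzag x m y n = concat (replicate n ((x # m) @ (y # rev m)))"

lemma zigzag_0: "zigzag x m y 0 = []"
  and zigzag_Suc: "zigzag x m y (Suc n) = (x # m) @ (y # rev m) @ zigzag x m y n"
  by (simp_all add: zigzag_def)

lemma set_zigzag: "set (zigzag x m y n) \<subseteq> set (x # m @ [y])"
  by (induction n) (auto simp: zigzag_0 zigzag_Suc)

lemma count_zigzag: "x \<notin> set (m @ [y]) \<Longrightarrow> count_list (zigzag x m y n) x = n"
  by (induction n) (auto simp: zigzag_0 zigzag_Suc)

lemma hd_zigzag: "zigzag x m y n \<noteq> [] \<Longrightarrow> hd (zigzag x m y n) = x"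
  by (cases n) (auto simp: zigzag_0 zigzag_Suc)

lemma successively_zigzag:
  assumes "successively R (x # m @ [y])" "symp R"
  shows "successively R (zigzag x m y n)"
proof (induction n)
  case (Suc n)
  have R: "R a b \<longleftrightarrow> R b a" for a b
    using assms(2) by (auto dest: sympD)
  have "successively R (rev (x # m @ [y]))"
    unfolding successively_rev using assms(1) by (subst R)
  then have backward: "successively R ((y # rev m) @ [x])"
    by simp
  have forward: "successively R ((x # m) @ [y])"
    using assms(1) by simp
  have "successively R ((y # rev m) @ zigzag x m y n)"
    using backward Suc hd_zigzag[of x m y n] unfolding successively_append_iff
    by (cases "zigzag x m y n = []") simp_all
  with forward show ?case
    unfolding zigzag_Suc successively_append_iff[of R "x # m"] by simp
qed (simp add: zigzag_0)

lemma fwf_unfilled: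
  assumes "distinct I" "finite C" "C \<inter> set I = {}" "card C + length I \<le> k"
  shows "faults (\<lambda>C. C) (fwf_step k) C I = length I \<and> foldl (fwf_step k) C I = C \<union> set I"
  using assms
proof (induction I arbitrary: C)
  case (Cons p I)
  then have step: "fwf_step k C p = insert p C" and p: "p \<notin> C"
    by (auto simp: fwf_step_def)
  have "card (insert p C) + length I \<le> k"
    using Cons.prems p by simp
  then show ?case
    using Cons.IH[of "insert p C"] Cons.prems p by (simp add: step)
qed simp

lemma fwf_flush:
  assumes "distinct (p # I)" "p \<notin> C" "C = {} \<or> card C = k" "length (p # I) = k"
  shows "faults (\<lambda>C. C) (fwf_step k) C (p # I) = k \<and> foldl (fwf_step k) C (p # I) = set (p # I)"
proof -
  have "fwf_step k C p = {p}"
    using assms by (auto simp: fwf_step_def)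
  then show ?thesis
    using fwf_unfilled[of I "{p}" k] assms by auto
qed

text \<open>Each half is a whole phase of \<open>k\<close> distinct pages, and its first page is
  absent from the cache left by the preceding half.\<close>

lemma FWF_zigzag:
  assumes "distinct (x # m @ [y])" "length (x # m) = k"
  shows "FWF k (zigzag x m y n) = 2 * k * n"
proof -
  have "faults (\<lambda>C. C) (fwf_step k) C (zigzag x m y n) = 2 * k * n"
    if "x \<notin> C" "C = {} \<or> card C = k" for C
    using that
  proof (induction n arbitrary: C)
    case (Suc n)
    have forward: "faults (\<lambda>C. C) (fwf_step k) C (x # m) = k \<and>
        foldl (fwf_step k) C (x # m) = set (x # m)"
      using Suc.prems assms by (intro fwf_flush) auto
    have card: "card (set (x # m)) = k" "card (set (y # rev m)) = k"
      using assms by (auto simp: distinct_card)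
    have backward: "faults (\<lambda>C. C) (fwf_step k) (set (x # m)) (y # rev m) = k \<and>
        foldl (fwf_step k) (set (x # m)) (y # rev m) = set (y # rev m)"
      using card assms by (intro fwf_flush) auto
    have "faults (\<lambda>C. C) (fwf_step k) (set (y # rev m)) (zigzag x m y n) = 2 * k * n"
      using card assms by (intro Suc.IH) auto
    then show ?case
      unfolding zigzag_Suc faults_append using forward backward by simp
  qed (simp add: zigzag_0)
  then show ?thesis
    by (simp add: FWF_def)
qed


section \<open>Worst orders and the ratio\<close>

lemma finite_worst_order: "finite {A J |J. mset J = mset I \<and> respects_graph G J}"
proof -
  have "finite {J. mset J = mset I}"
    by (rule mset_eq_finite)
  then have "finite (A ` {J. mset J = mset I})"
    by (rule finite_imageI)
  then show ?thesis
    by (rule rev_finite_subset) auto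
qed

lemma worst_order_ge:
  assumes "respects_graph G J" "mset J = mset I"
  shows "A J \<le> worst_order G A I"
  unfolding worst_order_def using assms by (intro Max_ge finite_worst_order) auto

lemma worst_order_le:
  assumes "respects_graph G I"
    and "\<And>J. respects_graph G J \<Longrightarrow> mset J = mset I \<Longrightarrow> A J \<le> N"
  shows "worst_order G A I \<le> N"
  unfolding worst_order_def using assms by (subst Max_le_iff[OF finite_worst_order]) auto

text \<open>The pointwise bound carries over to the maxima over reorderings, so \<open>c = 1\<close>
  is admissible with \<open>b = 0\<close>.\<close>

lemma c_l_ge_1:
  assumes "\<And>I. B I \<le> A I"
  shows "c_l G A B \<ge> 1"
proof -
  have "worst_order G B I \<le> worst_order G A I" if "respects_graph G I" for I
    using that by (intro worst_order_le order_trans[OF assms] worst_order_ge)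
  then have "1 \<in> {c. \<exists>b. \<forall>I. respects_graph G I \<longrightarrow>
      real (worst_order G A I) \<ge> c * real (worst_order G B I) - b}"
    by (auto intro!: exI[of _ 0])
  then show ?thesis
    unfolding c_l_def one_ereal_def by (intro Sup_upper imageI)
qed

text \<open>Along the family \<open>I n\<close> the costs grow at rate at least \<open>s\<close> and
  at most \<open>t\<close>; additive constants vanish in the limit.\<close>

lemma c_u_ge:
  fixes s t d :: real
  assumes I: "\<And>n. respects_graph G (I n)"
    and A: "\<And>n. s * real n \<le> real (worst_order G A (I n))"
    and B: "\<And>n. real (worst_order G B (I n)) \<le> t * real n + d"
    and "s > 0" "t > 0"
  shows "c_u G A B \<ge> ereal (s / t)"
  unfolding c_u_def
proof (rule Inf_greatest, clarify)
  fix c b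
  assume c: "\<forall>I. respects_graph G I \<longrightarrow>
    real (worst_order G A I) \<le> c * real (worst_order G B I) + b"
  \<comment> \<open>A candidate \<open>c\<close> may be negative; truncation allows the upper bound
    on \<open>B\<close> to be multiplied by it.\<close>
  define c' where "c' = max c 0"
  have "(s - c' * t) * real n \<le> c' * d + b" for n
  proof -
    have "s * real n \<le> c * real (worst_order G B (I n)) + b"
      using A c I by (meson order_trans)
    also have "c * real (worst_order G B (I n)) \<le> c' * real (worst_order G B (I n))"
      by (intro mult_right_mono) (auto simp: c'_def)
    also have "\<dots> \<le> c' * (t * real n + d)"
      using B by (intro mult_left_mono) (auto simp: c'_def)
    finally show ?thesis
      by (simp add: algebra_simps)
  qed
  then have "s - c' * t \<le> 0"
    by (metis ex_less_of_nat_mult mult.commute not_le)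
  then have "s / t \<le> c'"
    using \<open>t > 0\<close> by (simp add: divide_le_eq)
  \<comment> \<open>Positivity excludes \<open>c' = 0\<close>, hence \<open>c' = c\<close>.\<close>
  moreover have "s / t > 0"
    using assms by simp
  ultimately show "ereal (s / t) \<le> ereal c"
    by (auto simp: c'_def max_def split: if_splits)
qed

lemma successively_vwalk_arcs: "set (vwalk_arcs p) \<subseteq> E \<Longrightarrow> successively (\<lambda>u v. (u, v) \<in> E) p"
  by (induction p rule: vwalk_arcs.induct) auto

theorem theorem6:
  fixes G :: "('a, 'b) pre_digraph" and k :: nat
  assumes "sym_digraph G"
    and "k \<ge> 1"
    and "\<exists>p. vpath p G \<and> length p \<ge> k + 1"
  shows "\<exists>r. WR G (FWF k) (FIFO k) = Some r \<and> r \<ge> ereal (2 * real k / (real k + 1))"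
proof -
  define R where "R = (\<lambda>u v. u = v \<or> u \<rightarrow>\<^bsub>G\<^esub> v)"
  have "symp R"
    using sym_digraph.sym_arcs[OF assms(1)]
    by (auto simp: R_def symp_def symmetric_def dest: symD)
  obtain p where p: "vpath p G" "length p \<ge> k + 1"
    using assms(3) by blast
  \<comment> \<open>Exactly \<open>k + 1\<close> vertices are kept, as the FIFO bound is for
    \<open>k + 1\<close> pages.\<close>
  define q where "q = take (k + 1) p"
  have "successively R p"
    using p successively_vwalk_arcs[of p "arcs_ends G"]
    by (auto simp: vpath_def vwalk_def R_def elim!: successively_mono)
  then have walk: "successively R q"
    unfolding q_def by (metis append_take_drop_id successively_append_iff)
  have q: "distinct q" "length q = k + 1" "set q \<subseteq> verts G"
    using p by (auto simp: q_def vpath_def vwalk_def dest: in_set_takeD)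
  obtain x m y where xmy: "q = x # m @ [y]"
  proof -
    obtain x r where "q = x # r"
      using q by (cases q) auto
    moreover from this obtain m y where "r = m @ [y]"
      using q assms(2) by (cases r rule: rev_cases) auto
    ultimately show thesis
      using that by simp
  qed
  let ?Z = "zigzag x m y"
  have Z: "respects_graph G (?Z n)" for n
    using successively_zigzag[of R x m y n] walk \<open>symp R\<close> set_zigzag[of x m y n] q
    by (auto simp: respects_graph_def R_def xmy)
  have fwf: "2 * real k * real n \<le> real (worst_order G (FWF k) (?Z n))" for n
  proof -
    have "2 * k * n \<le> worst_order G (FWF k) (?Z n)"
      using worst_order_ge[OF Z refl, of "FWF k" n] FWF_zigzag[of x m y k n] q by (simp add: xmy)
    then show ?thesis
      by (metis of_nat_le_iff of_nat_mult of_nat_numeral)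
  qed
  have fifo: "real (worst_order G (FIFO k) (?Z n)) \<le> (real k + 1) * real n + 2 * real k" for n
  proof -
    have "worst_order G (FIFO k) (?Z n) \<le> (k + 1) * n + 2 * k"
    proof (rule worst_order_le[OF Z])
      fix J
      assume J: "mset J = mset (?Z n)"
      \<comment> \<open>Reordering preserves the two quantities on which
        \<open>FIFO_le_count\<close> rests.\<close>
      have "count_list J x = n"
        using J count_zigzag[of x m y n] q by (metis count_mset distinct.simps(2) xmy)
      moreover have "set J \<subseteq> set q"
        using J set_zigzag[of x m y n] by (metis mset_eq_setD xmy)
      ultimately show "FIFO k J \<le> (k + 1) * n + 2 * k"
        using FIFO_le_count[of "set q" k x J] q assms(2) by (simp add: distinct_card xmy)
    qed
    then have "real (worst_order G (FIFO k) (?Z n)) \<le> real ((k + 1) * n + 2 * k)"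
      by (rule of_nat_mono)
    then show ?thesis
      by (simp add: algebra_simps)
  qed
  have "c_u G (FWF k) (FIFO k) \<ge> ereal (2 * real k / (real k + 1))"
    using c_u_ge[OF Z fwf fifo] assms(2) by simp
  moreover have "c_l G (FWF k) (FIFO k) \<ge> 1"
    using assms(2) by (intro c_l_ge_1 FIFO_le_FWF)
  ultimately show ?thesis
    by (simp add: WR_def)
qed

end
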